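(* Let $\mathcal C=(c_{ij})_{i,j\ge0}$ be an infinite tridiagonal matrix with indeterminate (generic) nonzero entries, and $\mathcal Z_k=(\mathcal C^k)_{0,0}$. For every partition $\lambda=(\lambda_1\ge\dots\ge\lambda_n\ge0)$, $$\mathcal K_\lambda=\det\big(\mathcal K_{(\lambda_i+j-i,0,\dots,0)}\big)_{i,j=1}^n,$$ where the sequence $(\lambda_i+j-i,0,\dots,0)$ in the $(i,j)$ entry has exactly $n-j$ zeros.
   Context: For an integer sequence $\mu=(\mu_1,\dots,\mu_p)$ with $\mu_i+p-i\ge0$ for all $i$, define $$\mathcal K_{\mu}=\frac{\det\big(\mathcal Z_{\mu_i+2p-i-j}\big)_{i,j=1}^p}{\det\big(\mathcal Z_{2p-i-j}\big)_{i,j=1}^p}.$$ (For the entries on the right-hand side, $p=n-j+1$ and the condition $\mu_1+p-1=\lambda_i+n-i\ge0$ holds.) Here $c_{ij}=0$ whenever $|i-j|>1$, and the entries are assumed generic so that all denominators are nonzero. *)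

theory Defs
  imports "Jordan_Normal_Form.Determinant" "HOL-Library.Groups_Big_Fun"
begin

text \<open>Infinite matrices are functions on pairs of indices starting at 0. \<^const>\<open>Sum_any\<close>
  is the sum over the support, so the product is meaningful whenever each of these supports is finite,
  in particular for products of band matrices.\<close>

definition inf_mat_mult ::
  "(nat \<Rightarrow> nat \<Rightarrow> 'a::semiring_1) \<Rightarrow> (nat \<Rightarrow> nat \<Rightarrow> 'a) \<Rightarrow> nat \<Rightarrow> nat \<Rightarrow> 'a" where
  "inf_mat_mult A B = (\<lambda>i j. Sum_any (\<lambda>l. A i l * B l j))"

primrec inf_mat_pow :: "(nat \<Rightarrow> nat \<Rightarrow> 'a::semiring_1) \<Rightarrow> nat \<Rightarrow> nat \<Rightarrow> nat \<Rightarrow> 'a" where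
  "inf_mat_pow C 0 = (\<lambda>i j. if i = j then 1 else 0)"
| "inf_mat_pow C (Suc k) = inf_mat_mult (inf_mat_pow C k) C"

definition tridiagonal :: "(nat \<Rightarrow> nat \<Rightarrow> 'a::zero) \<Rightarrow> bool" where
  "tridiagonal C \<longleftrightarrow> (\<forall>i j. \<bar>int i - int j\<bar> > 1 \<longrightarrow> C i j = 0)"

definition Z :: "(nat \<Rightarrow> nat \<Rightarrow> 'a::semiring_1) \<Rightarrow> nat \<Rightarrow> 'a" where
  "Z C k = inf_mat_pow C k 0 0"

text \<open>The indices of \<^const>\<open>mat\<close> start at 0, hence the shifts \<open>i + 1\<close> and \<open>j + 1\<close> below.
  The subtraction of naturals in \<open>K_den\<close> never truncates, as \<open>i, j < p\<close>.\<close>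

definition K_den :: "(nat \<Rightarrow> nat \<Rightarrow> 'a::comm_ring_1) \<Rightarrow> nat \<Rightarrow> 'a" where
  "K_den C p = det (mat p p (\<lambda>(i, j). Z C (2 * p - (i + 1) - (j + 1))))"

text \<open>\<open>K C \<mu>\<close> is meant for sequences with \<open>\<mu>\<^sub>i + p - i \<ge> 0\<close> for \<open>1 \<le> i \<le> p\<close>, where \<open>p\<close> is the
  length of \<open>\<mu>\<close>; then the argument of \<^const>\<open>nat\<close> is nonnegative.\<close>

definition K :: "(nat \<Rightarrow> nat \<Rightarrow> 'a::field) \<Rightarrow> int list \<Rightarrow> 'a" where
  "K C \<mu> = (let p = length \<mu> in
     det (mat p p (\<lambda>(i, j). Z C (nat (\<mu> ! i + 2 * int p - int (i + 1) - int (j + 1)))))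
     / K_den C p)"

end

theory Submission
  imports Defs
begin

text \<open>Expanding the determinant in the entry \<open>(i, j)\<close> along its first row, the only row that depends on \<open>i\<close>, factors the
  matrix on the right as \<open>A T\<close>. Here \<open>det A\<close> is the numerator of \<open>K\<close> for the given partition and \<open>T\<close>
  is a lower triangular matrix of normalised first-row cofactors of Hankel matrices. The top-left
  corner minor of a Hankel matrix is the previous Hankel determinant, so \<open>det T\<close> telescopes to the
  reciprocal of the last one.\<close>

definition hankel :: "(nat \<Rightarrow> 'a) \<Rightarrow> nat \<Rightarrow> 'a mat" where
  "hankel z p = mat p p (\<lambda>(i, j). z (2 * p - (i + 1) - (j + 1)))"

lemma K_den_eq_det_hankel: "K_den C p = det (hankel (Z C) p)"
  by (simp add: K_den_def hankel_def)

lemma hankel_cofactor_corner: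
  assumes "p > 0"
  shows "cofactor (hankel z p) 0 0 = det (hankel z (p - 1))"
proof -
  have "mat_delete (hankel z p) 0 0 = hankel z (p - 1)"
    by (rule eq_matI) (auto simp: mat_delete_def hankel_def intro!: arg_cong[of _ _ z])
  then show ?thesis by (simp add: cofactor_def)
qed

lemma K_single_row_eq_sum:
  fixes C :: "nat \<Rightarrow> nat \<Rightarrow> 'a::field"
  assumes "p > 0" and "m + int p - 1 \<ge> 0"
  shows "K C (m # replicate (p - 1) 0) =
    (\<Sum>c<p. Z C (nat (m + int p - 1) + (p - 1 - c)) *
      (cofactor (hankel (Z C) p) 0 c / det (hankel (Z C) p)))"
proof -
  let ?M = "mat p p (\<lambda>(i, j).
    Z C (nat ((m # replicate (p - 1) 0) ! i + 2 * int p - int (i + 1) - int (j + 1))))"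
  have del: "mat_delete ?M 0 c = mat_delete (hankel (Z C) p) 0 c" if "c < p" for c
    using assms
    by (intro eq_matI) (auto simp: mat_delete_def hankel_def nth_Cons' intro!: arg_cong[of _ _ "Z C"])
  have "det ?M = (\<Sum>c<p. ?M $$ (0, c) * cofactor ?M 0 c)"
    using assms(1) by (intro laplace_expansion_row) auto
  also have "\<dots> = (\<Sum>c<p. Z C (nat (m + int p - 1) + (p - 1 - c)) * cofactor (hankel (Z C) p) 0 c)"
  proof (rule sum.cong[OF refl])
    fix c assume "c \<in> {..<p}"
    then have c: "c < p" by simp
    have "nat (m + 2 * int p - 1 - int (c + 1)) = nat (m + int p - 1) + (p - 1 - c)"
      using assms(2) c by linarith
    with c assms(1) have "?M $$ (0, c) = Z C (nat (m + int p - 1) + (p - 1 - c))"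
      by simp
    moreover have "cofactor ?M 0 c = cofactor (hankel (Z C) p) 0 c"
      unfolding cofactor_def del[OF c] ..
    ultimately show "?M $$ (0, c) * cofactor ?M 0 c =
      Z C (nat (m + int p - 1) + (p - 1 - c)) * cofactor (hankel (Z C) p) 0 c"
      by (rule arg_cong2)
  qed
  finally show ?thesis
    using assms(1) by (simp add: K_def Let_def K_den_eq_det_hankel sum_divide_distrib)
qed

definition hankel_cofactor_mat :: "(nat \<Rightarrow> 'a::field) \<Rightarrow> nat \<Rightarrow> 'a mat" where
  "hankel_cofactor_mat z n = mat n n (\<lambda>(k, j). if k < j then 0
     else cofactor (hankel z (n - j)) 0 (k - j) / det (hankel z (n - j)))"

lemma det_hankel_cofactor_mat:
  assumes "\<And>p. 1 \<le> p \<Longrightarrow> p \<le> n \<Longrightarrow> det (hankel z p) \<noteq> 0"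
  shows "det (hankel_cofactor_mat z n) = 1 / det (hankel z n)"
proof -
  let ?f = "\<lambda>j. det (hankel z (n - j))"
  have f0: "det (hankel z 0) = 1"
    by (simp add: hankel_def)
  have nz: "?f j \<noteq> 0" for j
    by (cases "n - j = 0") (use f0 assms in auto)
  have "det (hankel_cofactor_mat z n) = prod_list (diag_mat (hankel_cofactor_mat z n))"
    by (rule det_lower_triangular[of n]) (auto simp: hankel_cofactor_mat_def)
  also have "\<dots> = (\<Prod>j<n. hankel_cofactor_mat z n $$ (j, j))"
    by (simp add: prod_list_diag_prod hankel_cofactor_mat_def atLeast0LessThan)
  also have "\<dots> = (\<Prod>j<n. ?f (Suc j) / ?f j)"
    by (rule prod.cong) (auto simp: hankel_cofactor_mat_def hankel_cofactor_corner)
  also have "\<dots> = ?f n / ?f 0"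
    by (rule prod_lessThan_telescope) (use nz in auto)
  finally show ?thesis by (simp add: f0)
qed

theorem theorem5p1:
  fixes C :: "nat \<Rightarrow> nat \<Rightarrow> 'a::field" and la :: "nat list" and n :: nat
  assumes "tridiagonal C"
    and "\<And>i j. \<bar>int i - int j\<bar> \<le> 1 \<Longrightarrow> C i j \<noteq> 0"
    and "\<And>p. 1 \<le> p \<Longrightarrow> p \<le> n \<Longrightarrow> K_den C p \<noteq> 0"
    and "length la = n"
    and "sorted_wrt (\<ge>) la"
  shows "K C (map int la) =
    det (mat n n (\<lambda>(i, j).
      K C ((int (la ! i) + int (j + 1) - int (i + 1)) # replicate (n - (j + 1)) 0)))"
proof -
  define A where "A = mat n n (\<lambda>(i, k). Z C (la ! i + (n - 1 - i) + (n - 1 - k)))"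
  define T where "T = hankel_cofactor_mat (Z C) n"
  have A: "A \<in> carrier_mat n n" and T: "T \<in> carrier_mat n n"
    by (auto simp: A_def T_def hankel_cofactor_mat_def)
  have num: "mat n n (\<lambda>(i, j).
      Z C (nat (map int la ! i + 2 * int n - int (i + 1) - int (j + 1)))) = A"
    using assms(4) unfolding A_def
    by (intro eq_matI) (auto intro!: arg_cong[of _ _ "Z C"])
  have "mat n n (\<lambda>(i, j).
      K C ((int (la ! i) + int (j + 1) - int (i + 1)) # replicate (n - (j + 1)) 0)) = A * T"
    (is "?R = _")
  proof (rule eq_matI)
    fix i j assume "i < dim_row (A * T)" and "j < dim_col (A * T)"
    then have i: "i < n" and j: "j < n" using A T by auto
    let ?m = "int (la ! i) + int (j + 1) - int (i + 1)"
    let ?g = "\<lambda>k. A $$ (i, k) * T $$ (k, j)"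
    have m: "nat (?m + int (n - j) - 1) = la ! i + (n - 1 - i)" "?m + int (n - j) - 1 \<ge> 0"
      using i j by (auto simp: of_nat_diff)
    have "?R $$ (i, j) = K C (?m # replicate (n - j - 1) 0)"
      using i j by simp
    also have "\<dots> = (\<Sum>c<n - j. Z C (la ! i + (n - 1 - i) + (n - j - 1 - c)) *
      (cofactor (hankel (Z C) (n - j)) 0 c / det (hankel (Z C) (n - j))))"
      using j m by (subst K_single_row_eq_sum) auto
    also have "\<dots> = (\<Sum>c<n - j. ?g (c + j))"
      using i j by (intro sum.cong) (auto simp: A_def T_def hankel_cofactor_mat_def add.commute)
    also have "\<dots> = (\<Sum>k = j..<n. ?g k)"
      using j sum.shift_bounds_nat_ivl[of ?g 0 j "n - j"] by (simp add: atLeast0LessThan)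
    also have "\<dots> = (\<Sum>k<n. ?g k)"
      using j by (intro sum.mono_neutral_left) (auto simp: T_def hankel_cofactor_mat_def)
    also have "\<dots> = (A * T) $$ (i, j)"
      using i j A T by (simp add: scalar_prod_def atLeast0LessThan)
    finally show "?R $$ (i, j) = (A * T) $$ (i, j)" .
  qed (use A T in auto)
  then have "det ?R = det A * det T"
    using det_mult[OF A T] by simp
  also have "det T = 1 / K_den C n"
    using assms(3) by (simp add: T_def det_hankel_cofactor_mat K_den_eq_det_hankel)
  also have "det A * (1 / K_den C n) = K C (map int la)"
    using assms(4) by (simp add: K_def Let_def flip: num)
  finally show ?thesis by simp
qed

end
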